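(* Let $M=(E,\Delta)$ be a matroid of rank $r$ that is realizable over some field, and let $f_1$ be the number of elements of $E$ that are not loops. Then there exists an integer $k_0\le (f_1r)^{3r}$ such that for every integer $k\ge k_0$ the $h$-vector $(h_0',\ldots,h_r')$ of the $k$-fold thickening $M^k$ is log-concave, i.e. $(h'_j)^2\ge h'_{j-1}h'_{j+1}$ for $j=1,\ldots,r-1$.
   Context: For a matroid $M=(E,\Delta)$ of rank $r$ (with $\Delta$ the set of independent sets) let $f_i$ be the number of independent sets of size $i$ and $f_M(q)=\sum_{i=0}^r f_iq^{r-i}$. The $h$-polynomial is $h_M(q)=f_M(q-1)=\sum_{i=0}^r h_iq^{r-i}$, and $(h_0,\ldots,h_r)$ is the $h$-vector; equivalently $h_j=\sum_{i=0}^j(-1)^{j-i}\binom{r-i}{j-i}f_i$. For a positive integer $k$, the $k$-fold thickening $M^k$ is the matroid on ground set $E\times\{1,\ldots,k\}$ whose independent sets are the $I\subseteq E\times\{1,\ldots,k\}$ such that $\pi_E(I)\in\Delta$ and $|\pi_E(I)|=|I|$, where $\pi_E$ is the projection to $E$ (if $M$ is realized by a list $X$, $M^k$ is realized by the list containing $k$ copies of each element of $X$). A loop is an element $e$ with $\{e\}\notin\Delta$. Realizable means representable by a list of vectors over some field. *)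

theory Defs
  imports Main
begin

definition matroid :: "'e set \<Rightarrow> 'e set set \<Rightarrow> bool" where
  "matroid E \<Delta> \<longleftrightarrow> finite E \<and> \<Delta> \<subseteq> Pow E \<and> {} \<in> \<Delta> \<and>
     (\<forall>I J. J \<in> \<Delta> \<and> I \<subseteq> J \<longrightarrow> I \<in> \<Delta>) \<and>
     (\<forall>I J. I \<in> \<Delta> \<and> J \<in> \<Delta> \<and> card I < card J \<longrightarrow> (\<exists>x \<in> J - I. insert x I \<in> \<Delta>))"

definition mrank :: "'e set set \<Rightarrow> nat" where
  "mrank \<Delta> = Max (card ` \<Delta>)"

definition fnum :: "'e set set \<Rightarrow> nat \<Rightarrow> nat" where
  "fnum \<Delta> i = card {I \<in> \<Delta>. card I = i}"

definition hvec :: "'e set set \<Rightarrow> nat \<Rightarrow> int" where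
  "hvec \<Delta> j = (\<Sum>i=0..j. (-1) ^ (j - i) * int ((mrank \<Delta> - i) choose (j - i)) * int (fnum \<Delta> i))"

definition lin_indep_family :: "('e \<Rightarrow> nat \<Rightarrow> 'a::field) \<Rightarrow> 'e set \<Rightarrow> bool" where
  "lin_indep_family v I \<longleftrightarrow>
     (\<forall>c :: 'e \<Rightarrow> 'a. (\<forall>n. (\<Sum>e\<in>I. c e * v e n) = 0) \<longrightarrow> (\<forall>e\<in>I. c e = 0))"

definition realizable_over :: "'a::field itself \<Rightarrow> 'e set \<Rightarrow> 'e set set \<Rightarrow> bool" where
  "realizable_over _ E \<Delta> \<longleftrightarrow>
     (\<exists>v :: 'e \<Rightarrow> nat \<Rightarrow> 'a. \<forall>I \<subseteq> E. I \<in> \<Delta> \<longleftrightarrow> lin_indep_family v I)"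

definition thick_ground :: "'e set \<Rightarrow> nat \<Rightarrow> ('e \<times> nat) set" where
  "thick_ground E k = E \<times> {1..k}"

definition thick_indep :: "'e set \<Rightarrow> 'e set set \<Rightarrow> nat \<Rightarrow> ('e \<times> nat) set set" where
  "thick_indep E \<Delta> k =
     {I. I \<subseteq> E \<times> {1..k} \<and> fst ` I \<in> \<Delta> \<and> card (fst ` I) = card I}"

definition nonloops :: "'e set \<Rightarrow> 'e set set \<Rightarrow> nat" where
  "nonloops E \<Delta> = card {e \<in> E. {e} \<in> \<Delta>}"

end

theory Submission
  imports Defs "HOL-Analysis.Analysis"
begin

text \<open>Thickening multiplies $f_i$ by $k^i$ and preserves the rank, so $h'_j = k^j f_j + O(k^{j-1})$
  and log-concavity of $h'$ for large $k$ follows from $f_{j-1} f_{j+1} < f_j^2$; since the $f_i$ are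
  integers, the gap is at least $1$, which makes the threshold for $k$ explicit.

  The strict inequality comes from Mason's inequality
  $(j+1) f_{j-1} f_{j+1} \le j f_j^2$, valid for every matroid. Consider the
  homogeneous polynomials
  $F_d(\Delta) = \sum_{I \in \Delta} z^I y^{d-|I|} / (d-|I|)!$. Their partial derivatives are
  $\partial_y F_d(\Delta) = F_{d-1}(\Delta)$ and $\partial_{z_e} F_d(\Delta) = F_{d-1}(\Delta / e)$,
  so by induction on the degree the Hessian of $F_d(\Delta)$ at $(s,1,\ldots,1)$, $s > 0$, has only one
  positive eigenvalue: for $d = 2$ because parallelism is an equivalence relation on the nonloops, for
  larger $d$ by a trickling-down argument. Applied to the vector $e_y$ and the point itself,
  with $s \to 0$, this is Mason's inequality.\<close>

section \<open>Lorentzian symmetric forms\<close>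

definition bil :: "'a set \<Rightarrow> ('a \<Rightarrow> 'a \<Rightarrow> real) \<Rightarrow> ('a \<Rightarrow> real) \<Rightarrow> ('a \<Rightarrow> real) \<Rightarrow> real" where
  "bil S H x y = (\<Sum>a\<in>S. \<Sum>b\<in>S. x a * H a b * y b)"

lemma bil_alt: "bil S H x y = (\<Sum>a\<in>S. x a * (\<Sum>b\<in>S. H a b * y b))"
  by (simp add: bil_def sum_distrib_left mult.assoc)

lemma bil_sym:
  assumes "\<And>a b. H a b = H b a"
  shows "bil S H x y = bil S H y x"
  unfolding bil_def by (subst sum.swap) (simp add: assms mult.commute mult.left_commute)

lemma bil_add_scale_left: "bil S H (\<lambda>a. x a + t * y a) z = bil S H x z + t * bil S H y z"
  by (simp add: bil_def sum.distrib sum_distrib_left algebra_simps)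

lemma bil_add_scale_right: "bil S H z (\<lambda>a. x a + t * y a) = bil S H z x + t * bil S H z y"
  by (simp add: bil_def sum.distrib sum_distrib_left algebra_simps)

lemma bil_quadratic:
  assumes "\<And>a b. H a b = H b a"
  shows "bil S H (\<lambda>a. x a + t * y a) (\<lambda>a. x a + t * y a)
    = bil S H x x + 2 * t * bil S H x y + t\<^sup>2 * bil S H y y"
  using bil_sym[of H S y x, OF assms]
  by (simp add: bil_add_scale_left bil_add_scale_right power2_eq_square algebra_simps)

text \<open>By symmetry the columns outside \<open>T\<close> vanish along with the rows. This later
  discards loops.\<close>

lemma bil_mono_neutral:
  assumes "finite S" "T \<subseteq> S" "\<And>a b. a \<in> S - T \<Longrightarrow> H a b = 0" "\<And>a b. H a b = H b a"
  shows "bil S H x y = bil T H x y"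
proof -
  have "bil S H x y = (\<Sum>a\<in>T. \<Sum>b\<in>S. x a * H a b * y b)"
    unfolding bil_def by (rule sum.mono_neutral_right) (use assms in auto)
  also have "\<dots> = (\<Sum>a\<in>T. \<Sum>b\<in>T. x a * H a b * y b)"
  proof (rule sum.cong[OF refl])
    fix a assume "a \<in> T"
    show "(\<Sum>b\<in>S. x a * H a b * y b) = (\<Sum>b\<in>T. x a * H a b * y b)"
      by (rule sum.mono_neutral_right) (use assms in auto)
  qed
  finally show ?thesis by (simp add: bil_def)
qed

text \<open>One nonpositive value on the line \<open>x + t * w\<close> suffices: multiplying p + 2tq
  + t^2 r <= 0 by r >= 0 gives pr + (q + tr)^2 <= q^2. There is no division, so r = 0 is
  allowed.\<close>

lemma reverse_cauchy_schwarz: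
  assumes sym: "\<And>a b. H a b = H b a" and pos: "bil S H w w \<ge> 0"
    and neg: "bil S H (\<lambda>a. x a + t * w a) (\<lambda>a. x a + t * w a) \<le> 0"
  shows "bil S H x x * bil S H w w \<le> (bil S H x w)\<^sup>2"
proof -
  let ?p = "bil S H x x" and ?q = "bil S H x w" and ?r = "bil S H w w"
  have "?p + 2 * t * ?q + t\<^sup>2 * ?r \<le> 0"
    using neg by (simp add: bil_quadratic[of H S x t w, OF sym])
  then have "(?p + 2 * t * ?q + t\<^sup>2 * ?r) * ?r \<le> 0"
    using pos by (simp add: mult_nonpos_nonneg)
  moreover have "(?q + t * ?r)\<^sup>2 \<ge> 0" by simp
  ultimately show ?thesis
    by (simp add: power2_eq_square algebra_simps)
qed

section \<open>First variation and compactness, for maximising a quadratic form\<close>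

lemma linear_coeff_zero:
  fixes b c :: real
  assumes "\<And>t. 2 * t * b + t\<^sup>2 * c \<ge> 0"
  shows "b = 0"
proof (rule ccontr)
  assume b: "b \<noteq> 0"
  \<comment> \<open>At t = -b/m the expression equals (b^2/m)(c/m - 2); this \<open>m\<close> makes
    it negative whatever the sign of \<open>c\<close>.\<close>
  define m where "m = 1 + \<bar>c\<bar>"
  have m: "m > 0" "c < m" unfolding m_def by auto
  have "2 * (- b / m) * b + (- b / m)\<^sup>2 * c = b\<^sup>2 / m * (c / m - 2)"
    using m by (simp add: field_simps power2_eq_square)
  moreover have "b\<^sup>2 / m > 0" using b m by simp
  moreover have "c / m - 2 < 0" using m by (simp add: field_simps)
  ultimately have "2 * (- b / m) * b + (- b / m)\<^sup>2 * c < 0"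
    by (metis mult_pos_neg)
  with assms[of "- b / m"] show False by linarith
qed

text \<open>The index type may be infinite, so vectors are pinned to 0 off \<open>T\<close>; the set
  is then closed in a product of compact intervals, which is compact by Tychonoff.\<close>

lemma compact_ellipsoid:
  fixes D :: "'a \<Rightarrow> real" and l :: "('a \<Rightarrow> real) \<Rightarrow> real"
  assumes "finite T" "\<And>a. a \<in> T \<Longrightarrow> D a > 0" "continuous_on UNIV l"
  shows "compact {x. (\<forall>a. a \<notin> T \<longrightarrow> x a = 0) \<and> (\<Sum>a\<in>T. D a * (x a)\<^sup>2) = 1 \<and> l x = 0}"
    (is "compact ?K")
proof -
  \<comment> \<open>The radius \<open>1 + 1 / D a\<close> exceeds the sharp bound
    \<open>sqrt (1 / D a)\<close> and avoids the square root.\<close>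
  define Q where "Q = PiE UNIV (\<lambda>a. if a \<in> T then {- (1 + 1 / D a) .. 1 + 1 / D a} else {0::real})"
  have "compactin (product_topology (\<lambda>_. euclidean) UNIV) Q"
    unfolding Q_def by (subst compactin_PiE) auto
  then have Q: "compact Q"
    by (simp add: euclidean_product_topology)
  have cont: "continuous_on UNIV (\<lambda>x::'a \<Rightarrow> real. x a)" for a
    by (rule continuous_on_product_coordinates)
  have eq: "?K = (\<Inter>a\<in>-T. {x. x a = 0}) \<inter> {x. (\<Sum>a\<in>T. D a * (x a)\<^sup>2) = 1} \<inter> {x. l x = 0}"
    by auto
  have closed: "closed ?K"
    unfolding eq
    by (intro closed_Int closed_INT ballI closed_Collect_eq continuous_intros cont assms)
  have "?K \<subseteq> Q"
  proof
    fix x assume x: "x \<in> ?K"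
    have "x a \<in> {- (1 + 1 / D a) .. 1 + 1 / D a}" if a: "a \<in> T" for a
    proof -
      have "D a * (x a)\<^sup>2 \<le> (\<Sum>a\<in>T. D a * (x a)\<^sup>2)"
        by (rule member_le_sum[OF a]) (use assms(1) in \<open>auto intro!: mult_nonneg_nonneg less_imp_le[OF assms(2)]\<close>)
      then have "D a * (x a)\<^sup>2 \<le> 1" using x by simp
      then have "(x a)\<^sup>2 \<le> 1 / D a" using assms(2)[OF a] by (simp add: field_simps)
      also have "\<dots> \<le> (1 + 1 / D a)\<^sup>2"
        using assms(2)[OF a] by (simp add: power2_eq_square field_simps)
      finally have "\<bar>x a\<bar> \<le> 1 + 1 / D a"
        using assms(2)[OF a] by (subst (asm) abs_le_square_iff[symmetric]) auto
      then show ?thesis by auto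
    qed
    then show "x \<in> Q" using x by (auto simp: Q_def)
  qed
  then have "?K \<inter> Q = ?K" by blast
  then show ?thesis using closed_Int_compact[OF closed Q] by simp
qed

text \<open>With \<open>D = diag ((H w)\<^sub>a / w\<^sub>a)\<close>, the vector \<open>w\<close> is an eigenvector of \<open>inverse D H\<close> with eigenvalue 1.
  The hypothesis \<open>key\<close> says that \<open>H \<le> H inverse D H\<close>, so a positive eigenvalue is at least 1,
  and positivity of the row \<open>v0\<close> makes the Perron eigenvalue 1 simple and maximal.
  The eigenvector contradicting this is found by maximising the form on the orthogonal complement of \<open>w\<close>.\<close>
lemma lorentzian_step:
  fixes H :: "'a \<Rightarrow> 'a \<Rightarrow> real" and w :: "'a \<Rightarrow> real"
  assumes fin: "finite T" and v0: "v0 \<in> T" and sym: "\<And>a b. H a b = H b a"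
    and nonneg: "\<And>a b. H a b \<ge> 0" and star: "\<And>a. a \<in> T \<Longrightarrow> H v0 a > 0"
    and w: "\<And>a. a \<in> T \<Longrightarrow> w a > 0"
    and key: "\<And>x. bil T H x x \<le> (\<Sum>a\<in>T. w a * (\<Sum>b\<in>T. H a b * x b)\<^sup>2 / (\<Sum>b\<in>T. H a b * w b))"
  shows "bil T H x x * bil T H w w \<le> (bil T H x w)\<^sup>2"
proof -
  \<comment> \<open>Chosen so that D w = H w: orthogonality to \<open>w\<close> then means the same
    for \<open>H\<close> and for the positive form \<open>N\<close>.\<close>
  define D where "D a = (\<Sum>b\<in>T. H a b * w b) / w a" for a
  define N where "N x = (\<Sum>a\<in>T. D a * (x a)\<^sup>2)" for x
  have Hw: "(\<Sum>b\<in>T. H a b * w b) > 0" if "a \<in> T" for a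
  proof (rule sum_pos2[OF fin v0])
    show "0 < H a v0 * w v0" using star[OF that] w[OF v0] sym[of a v0] by simp
  qed (auto intro: mult_nonneg_nonneg nonneg less_imp_le w)
  have D: "D a > 0" if "a \<in> T" for a using Hw[OF that] w[OF that] by (simp add: D_def)
  have Dw: "D a * w a = (\<Sum>b\<in>T. H a b * w b)" if "a \<in> T" for a
    using w[OF that] by (simp add: D_def)
  have ww: "bil T H w w > 0"
    unfolding bil_alt by (rule sum_pos) (use fin v0 w Hw in auto)
  have xw: "bil T H x w = (\<Sum>a\<in>T. D a * x a * w a)" for x
  proof -
    have "x a * (\<Sum>b\<in>T. H a b * w b) = D a * x a * w a" if "a \<in> T" for a
      unfolding Dw[OF that, symmetric] by simp
    then show ?thesis unfolding bil_alt by (intro sum.cong) auto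
  qed
  have orth: "bil T H x x \<le> 0" if x0: "bil T H x w = 0" for x
  proof (rule ccontr)
    assume pos: "\<not> bil T H x x \<le> 0"
    define K where "K = {x. (\<forall>a. a \<notin> T \<longrightarrow> x a = 0) \<and> (\<Sum>a\<in>T. D a * (x a)\<^sup>2) = 1 \<and> bil T H x w = 0}"
    have cont: "continuous_on UNIV (\<lambda>x::'a \<Rightarrow> real. x a)" for a
      by (rule continuous_on_product_coordinates)
    have "compact K"
      unfolding K_def
      by (rule compact_ellipsoid[OF fin D]) (auto simp: bil_def intro!: continuous_intros cont)
    have norm: "\<exists>z\<in>K. bil T H y y = N y * bil T H z z" if y: "bil T H y w = 0" "N y > 0" for y
    proof
      define z where "z a = (if a \<in> T then 1 / sqrt (N y) * y a else 0)" for a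
      have zT: "bil T H z v = 1 / sqrt (N y) * bil T H y v" for v
        unfolding bil_def sum_distrib_left by (intro sum.cong) (auto simp: z_def)
      have zT': "bil T H v z = 1 / sqrt (N y) * bil T H v y" for v
        using zT[of v] bil_sym[of H, OF sym] by metis
      have "(\<Sum>a\<in>T. D a * (z a)\<^sup>2) = 1 / N y * N y"
        unfolding N_def[of y] sum_distrib_left
        by (intro sum.cong) (use y in \<open>auto simp: z_def power_mult_distrib power_divide N_def\<close>)
      then show "z \<in> K" using y by (auto simp: K_def zT) (simp add: z_def)
      have "sqrt (N y) * sqrt (N y) = N y" using y by simp
      then show "bil T H y y = N y * bil T H z z"
        using y by (simp add: zT zT')
    qed
    have Npos: "N y > 0" if "a \<in> T" "y a \<noteq> 0" for y a
      unfolding N_def by (rule sum_pos2[OF fin that(1)]) (use that D[OF that(1)] in \<open>auto intro!: mult_nonneg_nonneg less_imp_le[OF D]\<close>)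
    have Nnonneg: "N y \<ge> 0" for y
      unfolding N_def by (intro sum_nonneg mult_nonneg_nonneg) (auto intro: less_imp_le D)
    have N0: "bil T H y y = 0" if "N y = 0" for y
    proof -
      have "y a = 0" if "a \<in> T" for a using Npos[of a y] that \<open>N y = 0\<close> by force
      then show ?thesis by (simp add: bil_def)
    qed
    have "N x > 0" using N0[of x] pos Nnonneg[of x] by force
    then obtain z0 where z0: "z0 \<in> K" "bil T H x x = N x * bil T H z0 z0" using norm x0 by blast
    have "continuous_on K (\<lambda>z. bil T H z z)"
      unfolding bil_def by (intro continuous_intros continuous_on_subset[OF cont]) auto
    with \<open>compact K\<close> z0 obtain z where z: "z \<in> K" "\<And>y. y \<in> K \<Longrightarrow> bil T H y y \<le> bil T H z z"
      using continuous_attains_sup[of K "\<lambda>z. bil T H z z"] by auto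
    define \<mu> where "\<mu> = bil T H z z"
    have "bil T H z0 z0 > 0" using z0 pos \<open>N x > 0\<close> by (simp add: mult_le_0_iff)
    then have \<mu>: "\<mu> > 0" using z(2)[OF z0(1)] by (simp add: \<mu>_def)
    have zw: "bil T H z w = 0" and Nz: "N z = 1" using z by (auto simp: K_def N_def)
    have max: "bil T H y y \<le> \<mu> * N y" if "bil T H y w = 0" for y
    proof (cases "N y = 0")
      case False
      then have "N y > 0" using Nnonneg[of y] by simp
      with norm that obtain y' where "y' \<in> K" "bil T H y y = N y * bil T H y' y'" by blast
      then show ?thesis using z(2)[of y'] \<open>N y > 0\<close> by (simp add: \<mu>_def mult.commute)
    qed (use N0 in simp)
    \<comment> \<open>First variation: \<open>z + t * y\<close> stays orthogonal to
      \<open>w\<close>, and \<open>\<mu> * N - bil T H\<close> is nonnegative there and zero at t =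
      0.\<close>
    have perp: "bil T H z y = \<mu> * (\<Sum>a\<in>T. D a * z a * y a)" if y: "bil T H y w = 0" for y
    proof -
      let ?n = "\<Sum>a\<in>T. D a * z a * y a"
      have "\<mu> * ?n - bil T H z y = 0"
      proof (rule linear_coeff_zero)
        fix t
        have "N (\<lambda>a. z a + t * y a) = N z + 2 * t * ?n + t\<^sup>2 * N y"
          by (simp add: N_def sum_distrib_left sum.distrib power2_eq_square algebra_simps)
        moreover have "bil T H (\<lambda>a. z a + t * y a) w = 0"
          using y zw by (simp add: bil_add_scale_left)
        ultimately have "bil T H z z + 2 * t * bil T H z y + t\<^sup>2 * bil T H y y
            \<le> \<mu> * (N z + 2 * t * ?n + t\<^sup>2 * N y)"
          using max[of "\<lambda>a. z a + t * y a"] by (simp add: bil_quadratic[of H, OF sym])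
        then show "0 \<le> 2 * t * (\<mu> * ?n - bil T H z y) + t\<^sup>2 * (\<mu> * N y - bil T H y y)"
          using Nz by (simp add: \<mu>_def algebra_simps)
      qed
      then show ?thesis by simp
    qed
    \<comment> \<open>Every \<open>y\<close> is a vector orthogonal to \<open>w\<close> plus a
      multiple of \<open>w\<close>, and both sides vanish at \<open>w\<close>. So \<open>z\<close>
      is an eigenvector: H z = \<open>\<mu>\<close> D z.\<close>
    have all: "bil T H z y = \<mu> * (\<Sum>a\<in>T. D a * z a * y a)" for y
    proof -
      define t where "t = - bil T H y w / bil T H w w"
      have "bil T H (\<lambda>a. y a + t * w a) w = 0"
        unfolding bil_add_scale_left using ww by (simp add: t_def)
      from perp[OF this] have "bil T H z y + t * bil T H z w
          = \<mu> * ((\<Sum>a\<in>T. D a * z a * y a) + t * (\<Sum>a\<in>T. D a * z a * w a))"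
        by (simp add: bil_add_scale_right sum.distrib sum_distrib_left algebra_simps)
      then show ?thesis using zw by (simp add: xw[symmetric])
    qed
    have Hz: "(\<Sum>b\<in>T. H a b * z b) = \<mu> * (D a * z a)" if a: "a \<in> T" for a
    proof -
      have "bil T H z (\<lambda>b. if b = a then 1 else 0) = (\<Sum>b\<in>T. z b * H b a)"
        unfolding bil_def
        by (intro sum.cong) (use fin a in \<open>auto simp: if_distrib sum.delta cong: if_cong\<close>)
      moreover have "(\<Sum>b\<in>T. D b * z b * (if b = a then 1 else 0)) = D a * z a"
        using fin a by (simp add: if_distrib sum.delta cong: if_cong)
      moreover have "(\<Sum>b\<in>T. H a b * z b) = (\<Sum>b\<in>T. z b * H b a)"
        by (intro sum.cong) (use sym in \<open>auto simp: mult.commute\<close>)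
      ultimately show ?thesis using all[of "\<lambda>b. if b = a then 1 else 0"] by simp
    qed
    have "\<mu> \<le> (\<Sum>a\<in>T. w a * (\<mu> * (D a * z a))\<^sup>2 / (D a * w a))"
      using key[of z] Hz Dw by (simp add: \<mu>_def)
    also have "\<dots> = \<mu>\<^sup>2 * N z"
      unfolding N_def sum_distrib_left
      by (intro sum.cong) (auto simp: power2_eq_square field_simps dest!: D w)
    finally have "\<mu> \<ge> 1" using Nz \<mu> by (simp add: power2_eq_square)
    \<comment> \<open>The Dirichlet form identity behind \<open>H \<le> D\<close>; a zero Dirichlet form forces \<open>z\<close> to be a multiple of \<open>w\<close>.\<close>
    have "(\<Sum>a\<in>T. \<Sum>b\<in>T. H a b * w a * w b * (z a / w a - z b / w b)\<^sup>2)
        = (\<Sum>a\<in>T. \<Sum>b\<in>T. H a b * w b * (z a)\<^sup>2 / w a) + (\<Sum>a\<in>T. \<Sum>b\<in>T. H a b * w a * (z b)\<^sup>2 / w b)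
          - 2 * bil T H z z"
      unfolding bil_def sum_distrib_left sum.distrib[symmetric] sum_subtractf[symmetric]
    proof (intro sum.cong refl)
      fix a b assume "a \<in> T" "b \<in> T"
      then have "w a \<noteq> 0" "w b \<noteq> 0" using w less_imp_neq by metis+
      then show "H a b * w a * w b * (z a / w a - z b / w b)\<^sup>2
        = H a b * w b * (z a)\<^sup>2 / w a + H a b * w a * (z b)\<^sup>2 / w b - 2 * (z a * H a b * z b)"
        by (simp add: power2_eq_square field_simps)
    qed
    also have "(\<Sum>a\<in>T. \<Sum>b\<in>T. H a b * w a * (z b)\<^sup>2 / w b) = (\<Sum>a\<in>T. \<Sum>b\<in>T. H a b * w b * (z a)\<^sup>2 / w a)"
      by (subst sum.swap) (simp add: sym)
    also have "(\<Sum>a\<in>T. \<Sum>b\<in>T. H a b * w b * (z a)\<^sup>2 / w a) = N z"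
      unfolding N_def
      by (intro sum.cong) (auto simp: D_def sum_distrib_right sum_distrib_left sum_divide_distrib)
    finally have "(\<Sum>a\<in>T. \<Sum>b\<in>T. H a b * w a * w b * (z a / w a - z b / w b)\<^sup>2) \<le> 0"
      using Nz \<open>\<mu> \<ge> 1\<close> by (simp add: \<mu>_def)
    moreover have sq: "H a b * w a * w b * (z a / w a - z b / w b)\<^sup>2 \<ge> 0" if "a \<in> T" "b \<in> T" for a b
      using nonneg[of a b] w[OF that(1)] w[OF that(2)] by simp
    have "(\<Sum>b\<in>T. H v0 b * w v0 * w b * (z v0 / w v0 - z b / w b)\<^sup>2)
      \<le> (\<Sum>a\<in>T. \<Sum>b\<in>T. H a b * w a * w b * (z a / w a - z b / w b)\<^sup>2)"
      by (rule member_le_sum[OF v0]) (use sq fin in \<open>auto intro!: sum_nonneg\<close>)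
    ultimately have le0: "(\<Sum>b\<in>T. H v0 b * w v0 * w b * (z v0 / w v0 - z b / w b)\<^sup>2) \<le> 0" by linarith
    \<comment> \<open>Row \<open>v0\<close> is positive throughout, so all ratios
      \<open>z a / w a\<close> equal the one at \<open>v0\<close>. Orthogonality to \<open>w\<close>
      then forces z = 0 on \<open>T\<close>, against \<open>N z = 1\<close>.\<close>
    define c where "c = z v0 / w v0"
    have zc: "z a = c * w a" if a: "a \<in> T" for a
    proof -
      have "H v0 a * w v0 * w a * (z v0 / w v0 - z a / w a)\<^sup>2 \<le> 0"
        using le0 member_le_sum[OF a, of "\<lambda>b. H v0 b * w v0 * w b * (z v0 / w v0 - z b / w b)\<^sup>2"]
          sq v0 fin by fastforce
      moreover have "H v0 a * w v0 * w a > 0" using star[OF a] w[OF v0] w[OF a] by simp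
      ultimately have "(z v0 / w v0 - z a / w a)\<^sup>2 \<le> 0"
        by (metis mult_le_0_iff not_le)
      then have "z a / w a = c" by (simp add: c_def)
      then show ?thesis using w[OF a] by (simp add: field_simps)
    qed
    have "bil T H z w = c * bil T H w w"
      unfolding bil_def sum_distrib_left by (intro sum.cong) (auto simp: zc)
    then have "c = 0" using zw ww by simp
    then have "N z = 0" using zc by (simp add: N_def)
    with Nz show False by simp
  qed
  show ?thesis
  proof (rule reverse_cauchy_schwarz[OF sym])
    show "bil T H w w \<ge> 0" using ww by simp
    let ?t = "- bil T H x w / bil T H w w"
    show "bil T H (\<lambda>a. x a + ?t * w a) (\<lambda>a. x a + ?t * w a) \<le> 0"
      by (rule orth, unfold bil_add_scale_left) (use ww in simp)
  qed
qed

section \<open>The independence polynomial\<close>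

text \<open>The variable \<open>y\<close> is \<open>None\<close> and \<open>z\<^sub>e\<close> is \<open>Some e\<close>; \<open>link a\<close> is the effect of \<open>differentiation by a\<close> on the complex, so for a loop \<open>e\<close>
  it is the empty family. \<open>hess s d \<Delta>\<close> is the Hessian of \<open>F\<close> of degree \<open>d + 2\<close> at \<open>(s, 1, \<dots>, 1)\<close>.\<close>

primrec link :: "'e option \<Rightarrow> 'e set set \<Rightarrow> 'e set set" where
  "link None \<Delta> = \<Delta>"
| "link (Some e) \<Delta> = {I. e \<notin> I \<and> insert e I \<in> \<Delta>}"

text \<open>The contribution of a \<open>c\<close>-element set to F_d at y = s, z = 1. The guard is
  there because truncated subtraction would give 1 instead of 0 for c > d.\<close>

definition weight :: "real \<Rightarrow> nat \<Rightarrow> nat \<Rightarrow> real" where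
  "weight s d c = (if c \<le> d then s ^ (d - c) / fact (d - c) else 0)"

definition indpoly :: "real \<Rightarrow> nat \<Rightarrow> 'e set set \<Rightarrow> real" where
  "indpoly s d \<Delta> = (\<Sum>I\<in>\<Delta>. weight s d (card I))"

definition hess :: "real \<Rightarrow> nat \<Rightarrow> 'e set set \<Rightarrow> 'e option \<Rightarrow> 'e option \<Rightarrow> real" where
  "hess s d \<Delta> a b = indpoly s d (link a (link b \<Delta>))"

definition vars :: "'e set \<Rightarrow> 'e option set" where
  "vars E = insert None (Some ` E)"

definition pt :: "real \<Rightarrow> 'e option \<Rightarrow> real" where
  "pt s a = (case a of None \<Rightarrow> s | Some _ \<Rightarrow> 1)"

text \<open>Unlike \<open>matroid\<close>, this admits the empty family and is therefore closed under \<open>link\<close>.\<close>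
definition augmenting :: "'e set \<Rightarrow> 'e set set \<Rightarrow> bool" where
  "augmenting E \<Delta> \<longleftrightarrow> finite E \<and> \<Delta> \<subseteq> Pow E \<and>
     (\<forall>I J. J \<in> \<Delta> \<and> I \<subseteq> J \<longrightarrow> I \<in> \<Delta>) \<and>
     (\<forall>I J. I \<in> \<Delta> \<and> J \<in> \<Delta> \<and> card I < card J \<longrightarrow> (\<exists>x \<in> J - I. insert x I \<in> \<Delta>))"

lemma pt_simps [simp]: "pt s None = s" "pt s (Some e) = 1"
  by (simp_all add: pt_def)

lemma pt_pos: "s > 0 \<Longrightarrow> pt s a > 0"
  by (cases a) auto

lemma finite_vars [simp]: "finite E \<Longrightarrow> finite (vars E)"
  by (simp add: vars_def)

lemma sum_vars: "finite E \<Longrightarrow> (\<Sum>a\<in>vars E. f a) = f None + (\<Sum>e\<in>E. f (Some e))"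
  unfolding vars_def by (subst sum.insert) (auto simp: sum.reindex)

lemma link_commute: "link a (link b \<Delta>) = link b (link a \<Delta>)"
  by (cases a; cases b) (auto simp: insert_commute)

lemma link_empty [simp]: "link a {} = {}"
  by (cases a) auto

lemma indpoly_empty [simp]: "indpoly s d {} = 0"
  by (simp add: indpoly_def)

lemma augmentingD:
  assumes "augmenting E \<Delta>"
  shows "finite E" "\<Delta> \<subseteq> Pow E" "finite \<Delta>" "\<And>I. I \<in> \<Delta> \<Longrightarrow> finite I"
    "\<And>I J. J \<in> \<Delta> \<Longrightarrow> I \<subseteq> J \<Longrightarrow> I \<in> \<Delta>"
    "\<And>I J. I \<in> \<Delta> \<Longrightarrow> J \<in> \<Delta> \<Longrightarrow> card I < card J \<Longrightarrow> \<exists>x \<in> J - I. insert x I \<in> \<Delta>"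
proof -
  show "finite E" "\<Delta> \<subseteq> Pow E" using assms by (auto simp: augmenting_def)
  then show "finite \<Delta>" "\<And>I. I \<in> \<Delta> \<Longrightarrow> finite I"
    using finite_subset[of \<Delta> "Pow E"] finite_subset[of _ E] by auto
  show "\<And>I J. J \<in> \<Delta> \<Longrightarrow> I \<subseteq> J \<Longrightarrow> I \<in> \<Delta>"
    using assms unfolding augmenting_def by meson
  show "\<And>I J. I \<in> \<Delta> \<Longrightarrow> J \<in> \<Delta> \<Longrightarrow> card I < card J \<Longrightarrow> \<exists>x \<in> J - I. insert x I \<in> \<Delta>"
    using assms unfolding augmenting_def by meson
qed

text \<open>Exchange between \<open>insert e I\<close> and \<open>insert e J\<close> adds an element
  of \<open>J - I\<close> other than \<open>e\<close>, since \<open>e\<close> lies in both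
  sets.\<close>

lemma augmenting_link:
  assumes "augmenting E \<Delta>"
  shows "augmenting E (link a \<Delta>)"
proof (cases a)
  case (Some e)
  note A = augmentingD[OF assms]
  have "\<exists>x\<in>J - I. insert x I \<in> link a \<Delta>"
    if "I \<in> link a \<Delta>" "J \<in> link a \<Delta>" "card I < card J" for I J
  proof -
    have I: "e \<notin> I" "insert e I \<in> \<Delta>" and J: "e \<notin> J" "insert e J \<in> \<Delta>"
      using that Some by auto
    have "finite I" "finite J" using A(4)[OF I(2)] A(4)[OF J(2)] by auto
    then have "card (insert e I) < card (insert e J)" using I J that by simp
    from A(6)[OF I(2) J(2) this] show ?thesis
      using Some I J by (auto simp: insert_commute)
  qed
  moreover have "I \<in> link a \<Delta>" if "J \<in> link a \<Delta>" "I \<subseteq> J" for I J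
    using that Some A(5)[of "insert e J" "insert e I"] by auto
  moreover have "link a \<Delta> \<subseteq> Pow E" using Some A(2) by auto
  ultimately show ?thesis using A(1) unfolding augmenting_def by blast
qed (use assms in simp)

section \<open>Euler's relation for the independence polynomial and its Hessian\<close>

lemma indpoly_nonneg: "s > 0 \<Longrightarrow> indpoly s d \<Delta> \<ge> 0"
  unfolding indpoly_def weight_def by (intro sum_nonneg) auto

lemma indpoly_pos:
  assumes "s > 0" "finite \<Delta>" "{} \<in> \<Delta>"
  shows "indpoly s d \<Delta> > 0"
  unfolding indpoly_def
  by (rule sum_pos2[OF assms(2,3)]) (use assms in \<open>auto simp: weight_def\<close>)

text \<open>Euler's relation for one monomial of degree d + 1: \<open>c\<close> derivatives in
  z-variables and one in y. At c = 0 the truncated \<open>c - 1\<close> is multiplied by 0.\<close>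

lemma weight_euler:
  "real c * weight s d (c - 1) + weight s d c * s = real (Suc d) * weight s (Suc d) c"
proof (cases c)
  case 0
  then show ?thesis by (simp add: weight_def field_simps del: of_nat_Suc)
next
  case (Suc m)
  show ?thesis
  proof (cases "m < d")
    case True
    then obtain k where "d = m + Suc k" using less_iff_Suc_add by auto
    moreover have "s ^ k / fact k * s = real (Suc k) * (s ^ Suc k / fact (Suc k))"
      by (simp add: field_simps del: of_nat_Suc)
    ultimately show ?thesis using Suc by (simp add: weight_def field_simps del: power_Suc fact_Suc)
  qed (use Suc in \<open>auto simp: weight_def\<close>)
qed

lemma indpoly_link:
  assumes "\<And>I. I \<in> \<Delta> \<Longrightarrow> finite I" "finite \<Delta>"
  shows "indpoly s d (link (Some e) \<Delta>) = (\<Sum>I\<in>\<Delta>. if e \<in> I then weight s d (card I - 1) else 0)"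
proof -
  have "indpoly s d (link (Some e) \<Delta>) = (\<Sum>I\<in>{I\<in>\<Delta>. e \<in> I}. weight s d (card I - 1))"
    unfolding indpoly_def
  proof (rule sum.reindex_bij_witness[of _ "\<lambda>I. I - {e}" "insert e"])
    fix I assume I: "I \<in> link (Some e) \<Delta>"
    then have "finite I" using assms(1)[of "insert e I"] by simp
    then show "weight s d (card (insert e I) - 1) = weight s d (card I)" using I by simp
  qed (auto simp: insert_absorb)
  also have "\<dots> = (\<Sum>I\<in>\<Delta>. if e \<in> I then weight s d (card I - 1) else 0)"
    by (rule sum.inter_filter[OF assms(2)])
  finally show ?thesis .
qed

lemma indpoly_euler:
  assumes "augmenting E \<Delta>"
  shows "(\<Sum>a\<in>vars E. indpoly s d (link a \<Delta>) * pt s a) = real (Suc d) * indpoly s (Suc d) \<Delta>"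
proof -
  note A = augmentingD[OF assms]
  have "(\<Sum>e\<in>E. indpoly s d (link (Some e) \<Delta>))
      = (\<Sum>I\<in>\<Delta>. \<Sum>e\<in>E. if e \<in> I then weight s d (card I - 1) else 0)"
    by (subst sum.swap) (simp add: indpoly_link[OF A(4,3)] del: link.simps)
  also have "\<dots> = (\<Sum>I\<in>\<Delta>. real (card I) * weight s d (card I - 1))"
  proof (rule sum.cong[OF refl])
    fix I assume "I \<in> \<Delta>"
    then have "{e \<in> E. e \<in> I} = I" using A(2) by auto
    then show "(\<Sum>e\<in>E. if e \<in> I then weight s d (card I - 1) else 0) = real (card I) * weight s d (card I - 1)"
      using sum.inter_filter[OF A(1), of "\<lambda>_. weight s d (card I - 1)" "\<lambda>e. e \<in> I"] by simp
  qed
  finally have "(\<Sum>a\<in>vars E. indpoly s d (link a \<Delta>) * pt s a)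
      = (\<Sum>I\<in>\<Delta>. real (card I) * weight s d (card I - 1) + weight s d (card I) * s)"
    by (simp add: sum_vars[OF A(1)] sum.distrib indpoly_def[of s d \<Delta>] sum_distrib_right del: link.simps(2))
  then show ?thesis by (simp only: weight_euler indpoly_def sum_distrib_left)
qed

lemma hess_sym: "hess s d \<Delta> a b = hess s d \<Delta> b a"
  by (simp add: hess_def link_commute)

lemma hess_euler:
  assumes "augmenting E \<Delta>"
  shows "(\<Sum>b\<in>vars E. hess s d \<Delta> a b * pt s b) = real (Suc d) * indpoly s (Suc d) (link a \<Delta>)"
  unfolding hess_def
  by (subst link_commute) (rule indpoly_euler[OF augmenting_link[OF assms]])

lemma link_loop:
  assumes "augmenting E \<Delta>" "a \<in> vars E - vars {e \<in> E. {e} \<in> \<Delta>}"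
  shows "link a \<Delta> = {}"
proof -
  obtain e where "a = Some e" "{e} \<notin> \<Delta>" using assms(2) by (auto simp: vars_def)
  then show ?thesis using augmentingD(5)[OF assms(1), of _ "{e}"] by auto
qed

text \<open>Loops have zero rows. Dropping them leaves a positive \<open>None\<close> row if
  \<open>{}\<close> is independent, as \<open>lorentzian_step\<close> demands.\<close>

lemma hess_bil_nonloops:
  assumes "augmenting E \<Delta>"
  shows "bil (vars E) (hess s d \<Delta>) x y = bil (vars {e \<in> E. {e} \<in> \<Delta>}) (hess s d \<Delta>) x y"
proof (rule bil_mono_neutral)
  show "finite (vars E)" using augmentingD(1)[OF assms] by simp
  show "hess s d \<Delta> a b = 0" if "a \<in> vars E - vars {e \<in> E. {e} \<in> \<Delta>}" for a b
    using link_loop[OF assms that] by (simp add: hess_def link_commute[of a])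
qed (auto simp: vars_def hess_sym)

lemma bil_hess_nonneg: "s > 0 \<Longrightarrow> bil S (hess s d \<Delta>) (pt s) (pt s) \<ge> 0"
  unfolding bil_def hess_def
  by (intro sum_nonneg mult_nonneg_nonneg indpoly_nonneg less_imp_le[OF pt_pos])

section \<open>The Hessian in degree two and parallel classes\<close>

lemma equivalence_form_nonneg:
  fixes x :: "'a \<Rightarrow> real"
  assumes "finite S"
  shows "(\<Sum>e\<in>S. \<Sum>f\<in>S. if c e = c f then x e * x f else 0) \<ge> 0"
proof -
  have "(\<Sum>e\<in>S. \<Sum>f\<in>S. if c e = c f then x e * x f else 0) = (\<Sum>e\<in>S. x e * (\<Sum>f | f \<in> S \<and> c f = c e. x f))"
    unfolding sum_distrib_left sum.inter_filter[OF assms]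
    by (intro sum.cong) auto
  \<comment> \<open>Grouping by the label \<open>c\<close> yields a sum of squares of class
    sums.\<close>
  also have "\<dots> = (\<Sum>y\<in>c ` S. \<Sum>e | e \<in> S \<and> c e = y. x e * (\<Sum>f | f \<in> S \<and> c f = c e. x f))"
    by (rule sum.image_gen[OF assms])
  also have "\<dots> = (\<Sum>y\<in>c ` S. (\<Sum>e | e \<in> S \<and> c e = y. x e)\<^sup>2)"
    unfolding power2_eq_square sum_distrib_right by (intro sum.cong) auto
  also have "\<dots> \<ge> 0" by (intro sum_nonneg) auto
  finally show ?thesis .
qed

text \<open>Parallel classes serve as labels for \<open>equivalence_form_nonneg\<close>.\<close>

lemma parallel_class_eq:
  assumes "augmenting E \<Delta>" "{e} \<in> \<Delta>" "{f} \<in> \<Delta>"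
  shows "{g. {g} \<in> \<Delta> \<and> (g = e \<or> {e, g} \<notin> \<Delta>)} = {g. {g} \<in> \<Delta> \<and> (g = f \<or> {f, g} \<notin> \<Delta>)}
    \<longleftrightarrow> e = f \<or> {e, f} \<notin> \<Delta>"
proof -
  \<comment> \<open>Transitivity is one exchange: an independent pair \<open>{a, c}\<close> would
    augment \<open>{b}\<close>.\<close>
  have trans: "{a, c} \<notin> \<Delta>" if "{a} \<in> \<Delta>" "{b} \<in> \<Delta>" "{c} \<in> \<Delta>" "{a, b} \<notin> \<Delta>" "{b, c} \<notin> \<Delta>" "a \<noteq> c" for a b c
  proof
    assume "{a, c} \<in> \<Delta>"
    from augmentingD(6)[OF assms(1) that(2) this] that(6)
    have "\<exists>x\<in>{a, c} - {b}. insert x {b} \<in> \<Delta>" by simp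
    then show False using that by (auto simp: insert_commute)
  qed
  show ?thesis (is "?L = ?R \<longleftrightarrow> _")
  proof
    assume "?L = ?R"
    then have "f \<in> ?L \<longleftrightarrow> f \<in> ?R" by (rule arg_cong)
    then show "e = f \<or> {e, f} \<notin> \<Delta>" using assms(3) by auto
  next
    assume ef: "e = f \<or> {e, f} \<notin> \<Delta>"
    have sub: "{g. {g} \<in> \<Delta> \<and> (g = a \<or> {a, g} \<notin> \<Delta>)} \<subseteq> {g. {g} \<in> \<Delta> \<and> (g = b \<or> {b, g} \<notin> \<Delta>)}"
      if "{a} \<in> \<Delta>" "{b} \<in> \<Delta>" "b = a \<or> {b, a} \<notin> \<Delta>" for a b
      using that trans[of b a] by blast
    have "{f, e} = {e, f}" by blast
    then have "f = e \<or> {f, e} \<notin> \<Delta>" using ef by auto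
    then show "?L = ?R"
      by (intro equalityI sub assms(2,3) ef)
  qed
qed

lemma hess_base:
  assumes aug: "augmenting E \<Delta>" and s: "s > 0"
  shows "bil (vars E) (hess s 0 \<Delta>) x x * bil (vars E) (hess s 0 \<Delta>) (pt s) (pt s)
    \<le> (bil (vars E) (hess s 0 \<Delta>) x (pt s))\<^sup>2"
proof (cases "{} \<in> \<Delta>")
  case False
  then have "\<Delta> = {}" using augmentingD(5)[OF aug] by blast
  then show ?thesis by (simp add: bil_def hess_def)
next
  case True
  note A = augmentingD[OF aug]
  define N where "N = {e \<in> E. {e} \<in> \<Delta>}"
  have N: "finite N" using A(1) by (simp add: N_def)
  define c where "c e = {g. {g} \<in> \<Delta> \<and> (g = e \<or> {e, g} \<notin> \<Delta>)}" for e
  have ind0: "indpoly s 0 \<Gamma> = (if {} \<in> \<Gamma> then 1 else 0)" if "augmenting E \<Gamma>" for \<Gamma> :: "'a set set"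
  proof -
    note G = augmentingD[OF that]
    have "indpoly s 0 \<Gamma> = (\<Sum>I\<in>\<Gamma>. if I = {} then 1 else 0)"
      unfolding indpoly_def weight_def by (intro sum.cong) (use G(4) in auto)
    then show ?thesis using G(3) by (simp add: sum.delta)
  qed
  have h: "hess s 0 \<Delta> a b = (if {} \<in> link a (link b \<Delta>) then 1 else 0)" for a b
    unfolding hess_def by (intro ind0 augmenting_link aug)
  define L where "L y = y None + (\<Sum>e\<in>N. y (Some e))" for y :: "'a option \<Rightarrow> real"
  define P where "P y = (\<Sum>e\<in>N. \<Sum>f\<in>N. if c e = c f then y (Some e) * y (Some f) else 0)" for y :: "'a option \<Rightarrow> real"
  have hN: "hess s 0 \<Delta> None None = 1" "\<And>e. e \<in> N \<Longrightarrow> hess s 0 \<Delta> None (Some e) = 1"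
     "\<And>e. e \<in> N \<Longrightarrow> hess s 0 \<Delta> (Some e) None = 1"
    using True by (auto simp: h N_def)
  have hS: "hess s 0 \<Delta> (Some e) (Some f) = 1 - (if c e = c f then 1 else 0)" if "e \<in> N" "f \<in> N" for e f
    using parallel_class_eq[OF aug, of e f] that unfolding c_def[symmetric]
    by (auto simp: h N_def insert_commute)
  \<comment> \<open>On \<open>None\<close> and the nonloops all entries are 1, except 0 between
    parallel elements (an element and itself included). So the form is at most 0 where
    \<open>L\<close> vanishes.\<close>
  have form: "bil (vars E) (hess s 0 \<Delta>) y y = (L y)\<^sup>2 - P y" for y
  proof -
    have "bil (vars E) (hess s 0 \<Delta>) y y = bil (vars N) (hess s 0 \<Delta>) y y"
      unfolding N_def by (rule hess_bil_nonloops[OF aug])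
    also have "\<dots> = y None * y None + (\<Sum>e\<in>N. y None * y (Some e)) + (\<Sum>e\<in>N. y (Some e) * y None) +
        (\<Sum>e\<in>N. \<Sum>f\<in>N. y (Some e) * (1 - (if c e = c f then 1 else 0)) * y (Some f))"
      unfolding bil_def using N by (simp add: sum_vars hN hS sum.distrib)
    also have "(\<Sum>e\<in>N. \<Sum>f\<in>N. y (Some e) * (1 - (if c e = c f then 1 else 0)) * y (Some f))
       = (\<Sum>e\<in>N. y (Some e)) * (\<Sum>f\<in>N. y (Some f)) - P y"
      unfolding P_def sum_product sum_subtractf[symmetric] by (intro sum.cong) auto
    finally show ?thesis
      by (simp add: L_def power2_eq_square algebra_simps sum_distrib_left sum_distrib_right)
  qed
  have Lw: "L (pt s) > 0" using s by (simp add: L_def add_pos_nonneg)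
  show ?thesis
  proof (rule reverse_cauchy_schwarz)
    let ?t = "- L x / L (pt s)"
    have "L (\<lambda>a. x a + t * pt s a) = L x + t * L (pt s)" for t
      by (simp add: L_def sum.distrib sum_distrib_left algebra_simps)
    from this[of ?t] have "L (\<lambda>a. x a + ?t * pt s a) = 0" using Lw by simp
    moreover have "P (\<lambda>a. x a + ?t * pt s a) \<ge> 0"
      unfolding P_def by (rule equivalence_form_nonneg[OF N])
    ultimately show "bil (vars E) (hess s 0 \<Delta>) (\<lambda>a. x a + ?t * pt s a) (\<lambda>a. x a + ?t * pt s a) \<le> 0"
      unfolding form by simp
  qed (rule hess_sym bil_hess_nonneg[OF s])+
qed

section \<open>Mason's inequality\<close>

text \<open>The Hessian is, up to the factor d + 1, the sum of the Hessians of the links weighted by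
  \<open>pt s\<close>. Bounding each by the induction hypothesis produces the hypothesis
  \<open>key\<close> of \<open>lorentzian_step\<close>.\<close>

theorem hess_lorentzian:
  assumes aug: "augmenting E \<Delta>" and s: "s > 0"
  shows "bil (vars E) (hess s d \<Delta>) x x * bil (vars E) (hess s d \<Delta>) (pt s) (pt s)
    \<le> (bil (vars E) (hess s d \<Delta>) x (pt s))\<^sup>2"
  using aug
proof (induction d arbitrary: \<Delta> x)
  case 0
  then show ?case by (intro hess_base s)
next
  case (Suc d)
  note A = augmentingD[OF Suc.prems]
  show ?case
  proof (cases "{} \<in> \<Delta>")
    case False
    then have "\<Delta> = {}" using A(5) by blast
    then show ?thesis by (simp add: bil_def hess_def)
  next
    case True
    define T where "T = vars {e \<in> E. {e} \<in> \<Delta>}"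
    define H where "H = hess s (Suc d) \<Delta>"
    define R where "R x c = (\<Sum>b\<in>vars E. H c b * x b)" for x c
    have TV: "T \<subseteq> vars E" by (auto simp: T_def vars_def)
    have finT: "finite T" using A(1) by (simp add: T_def)
    have H0: "H a b = 0" if "a \<in> vars E - T" for a b
      using link_loop[OF Suc.prems] that by (simp add: H_def hess_def link_commute[of a] T_def)
    have Hsym: "H a b = H b a" for a b by (simp add: H_def hess_sym)
    have Hnn: "H a b \<ge> 0" for a b by (simp add: H_def hess_def indpoly_nonneg s)
    have star: "H None a > 0" if "a \<in> T" for a
    proof -
      have "{} \<in> link a \<Delta>" using that True by (auto simp: T_def vars_def)
      then show ?thesis
        using indpoly_pos[OF s augmentingD(3)[OF augmenting_link[OF Suc.prems]]]
        by (simp add: H_def hess_def)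
    qed
    have RT: "R x c = (\<Sum>b\<in>T. H c b * x b)" for x c
      unfolding R_def
      by (rule sum.mono_neutral_right) (use TV A(1) H0 Hsym in auto)
    have Rpos: "R (pt s) c > 0" if c: "c \<in> T" for c
      unfolding RT
    proof (rule sum_pos2[OF finT])
      show "None \<in> T" by (simp add: T_def vars_def)
      show "0 < H c None * pt s None" using star[OF c] s Hsym[of c None] by simp
    qed (intro mult_nonneg_nonneg Hnn less_imp_le[OF pt_pos[OF s]])
    define B where "B c = bil (vars E) (hess s d (link c \<Delta>))" for c
    have Bxw: "B c x (pt s) = real (Suc d) * R x c" for c x
    proof -
      have "B c x (pt s) = (\<Sum>a\<in>vars E. x a * (real (Suc d) * H c a))"
        unfolding B_def bil_alt hess_euler[OF augmenting_link[OF Suc.prems]]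
        by (simp add: H_def hess_def link_commute)
      then show ?thesis by (simp add: R_def sum_distrib_left mult_ac)
    qed
    \<comment> \<open>Each entry of \<open>H\<close> is homogeneous of degree d + 1, so Euler's
      relation recovers it from its derivatives, which are the entries of the links'
      Hessians.\<close>
    have key: "real (Suc d) * bil T H x x = (\<Sum>c\<in>vars E. pt s c * B c x x)" for x
    proof -
      have "(\<Sum>c\<in>vars E. pt s c * B c x x)
          = (\<Sum>a\<in>vars E. \<Sum>b\<in>vars E. \<Sum>c\<in>vars E. x a * x b * (hess s d (link c \<Delta>) a b * pt s c))"
        unfolding B_def bil_def sum_distrib_left
        by (subst sum.swap, rule sum.cong[OF refl], subst sum.swap) (simp add: mult_ac)
      also have "\<dots> = (\<Sum>a\<in>vars E. \<Sum>b\<in>vars E. x a * x b * (real (Suc d) * H a b))"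
      proof (intro sum.cong refl)
        fix a b
        have "hess s d (link c \<Delta>) a b = indpoly s d (link c (link a (link b \<Delta>)))" for c
          unfolding hess_def by (metis link_commute)
        then have "(\<Sum>c\<in>vars E. hess s d (link c \<Delta>) a b * pt s c) = real (Suc d) * H a b"
          using indpoly_euler[OF augmenting_link[OF augmenting_link[OF Suc.prems]], of s d a b]
          by (simp add: H_def hess_def)
        then show "(\<Sum>c\<in>vars E. x a * x b * (hess s d (link c \<Delta>) a b * pt s c)) = x a * x b * (real (Suc d) * H a b)"
          unfolding sum_distrib_left[symmetric] by simp
      qed
      also have "\<dots> = real (Suc d) * bil (vars E) H x x"
        by (simp add: bil_def sum_distrib_left mult_ac)
      also have "bil (vars E) H x x = bil T H x x"
        unfolding H_def T_def by (rule hess_bil_nonloops[OF Suc.prems])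
      finally show ?thesis by simp
    qed
    \<comment> \<open>By \<open>Bxw\<close>, \<open>B c (pt s) (pt s)\<close> is d + 1 times
      \<open>R (pt s) c\<close>, positive for \<open>c\<close> in \<open>T\<close>, so the induction
      hypothesis can be divided by it.\<close>
    have IH: "B c x x \<le> real (Suc d) * ((R x c)\<^sup>2 / R (pt s) c)" if c: "c \<in> T" for c x
    proof -
      have "B c x x * B c (pt s) (pt s) \<le> (B c x (pt s))\<^sup>2"
        unfolding B_def by (rule Suc.IH[OF augmenting_link[OF Suc.prems]])
      then have "B c x x * R (pt s) c * real (Suc d) \<le> (R x c)\<^sup>2 * real (Suc d) * real (Suc d)"
        by (simp add: Bxw power2_eq_square mult_ac del: of_nat_Suc)
      then have "B c x x * R (pt s) c \<le> (R x c)\<^sup>2 * real (Suc d)"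
        by (rule mult_right_le_imp_le) simp
      then show ?thesis using Rpos[OF c] by (simp add: field_simps del: of_nat_Suc)
    qed
    have main: "bil T H x x \<le> (\<Sum>a\<in>T. pt s a * (\<Sum>b\<in>T. H a b * x b)\<^sup>2 / (\<Sum>b\<in>T. H a b * pt s b))" for x
    proof -
      have "real (Suc d) * bil T H x x = (\<Sum>c\<in>T. pt s c * B c x x)"
        unfolding key
      proof (rule sum.mono_neutral_right)
        show "\<forall>c\<in>vars E - T. pt s c * B c x x = 0"
          using link_loop[OF Suc.prems] by (simp add: B_def bil_def hess_def T_def)
      qed (use A(1) TV in auto)
      also have "\<dots> \<le> (\<Sum>c\<in>T. pt s c * (real (Suc d) * ((R x c)\<^sup>2 / R (pt s) c)))"
        by (intro sum_mono mult_left_mono IH less_imp_le[OF pt_pos[OF s]])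
      also have "\<dots> = real (Suc d) * (\<Sum>c\<in>T. pt s c * (R x c)\<^sup>2 / R (pt s) c)"
        by (simp add: sum_distrib_left mult_ac del: of_nat_Suc)
      finally have "bil T H x x \<le> (\<Sum>c\<in>T. pt s c * (R x c)\<^sup>2 / R (pt s) c)"
        by (rule mult_left_le_imp_le) simp
      then show ?thesis by (simp only: RT)
    qed
    have "bil T H x x * bil T H (pt s) (pt s) \<le> (bil T H x (pt s))\<^sup>2"
    proof (rule lorentzian_step)
      show "None \<in> T" by (simp add: T_def vars_def)
    qed (rule finT Hsym Hnn star pt_pos[OF s] main; assumption?)+
    then show ?thesis
      unfolding H_def T_def hess_bil_nonloops[OF Suc.prems, symmetric] .
  qed
qed

section \<open>From the Hessian to the numbers of independent sets\<close>

lemma indpoly_log_concave: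
  assumes aug: "augmenting E \<Delta>" and s: "s > 0"
  shows "real (d + 2) * indpoly s d \<Delta> * indpoly s (d + 2) \<Delta> \<le> real (d + 1) * (indpoly s (d + 1) \<Delta>)\<^sup>2"
proof -
  note A = augmentingD[OF aug]
  \<comment> \<open>The unit vector of y: the three form values become F_d, (d+1) F_{d+1} and, for
    \<open>pt s\<close> with itself, (d+1)(d+2) F_{d+2}.\<close>
  define x :: "'a option \<Rightarrow> real" where "x a = (if a = None then 1 else 0)" for a
  have x: "bil (vars E) (hess s d \<Delta>) x y = (\<Sum>b\<in>vars E. hess s d \<Delta> None b * y b)" for y
    unfolding bil_alt using A(1) by (simp add: sum_vars x_def)
  have xx: "bil (vars E) (hess s d \<Delta>) x x = indpoly s d \<Delta>"
    unfolding x using A(1) by (simp add: sum_vars x_def hess_def)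
  have xw: "bil (vars E) (hess s d \<Delta>) x (pt s) = real (d + 1) * indpoly s (d + 1) \<Delta>"
    unfolding x hess_euler[OF aug] by simp
  have "bil (vars E) (hess s d \<Delta>) (pt s) (pt s)
      = real (d + 1) * (\<Sum>a\<in>vars E. indpoly s (d + 1) (link a \<Delta>) * pt s a)"
    unfolding bil_alt hess_euler[OF aug] sum_distrib_left by (simp add: mult_ac)
  also have "\<dots> = real (d + 1) * (real (d + 2) * indpoly s (d + 2) \<Delta>)"
    using indpoly_euler[OF aug, of s "d + 1"] by simp
  finally have ww: "bil (vars E) (hess s d \<Delta>) (pt s) (pt s) = real (d + 1) * (real (d + 2) * indpoly s (d + 2) \<Delta>)" .
  have "(real (d + 2) * indpoly s d \<Delta> * indpoly s (d + 2) \<Delta>) * real (d + 1)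
      \<le> (real (d + 1) * (indpoly s (d + 1) \<Delta>)\<^sup>2) * real (d + 1)"
    using hess_lorentzian[OF aug s, of d x] unfolding xx xw ww
    by (simp add: power2_eq_square mult_ac del: of_nat_Suc of_nat_add)
  then show ?thesis by (rule mult_right_le_imp_le) simp
qed

text \<open>Since 0^0 = 1, exactly the sets of size \<open>d\<close> survive.\<close>

lemma indpoly_at_0:
  assumes "finite \<Delta>"
  shows "indpoly 0 d \<Delta> = real (card {I \<in> \<Delta>. card I = d})"
proof -
  have "indpoly 0 d \<Delta> = (\<Sum>I\<in>\<Delta>. if card I = d then 1 else 0)"
    unfolding indpoly_def weight_def by (intro sum.cong) (auto simp: power_0_left)
  then show ?thesis using sum.inter_filter[OF assms, of "\<lambda>_. 1::real" "\<lambda>I. card I = d"] by simp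
qed

theorem mason_inequality:
  assumes "augmenting E \<Delta>"
  shows "(d + 2) * card {I \<in> \<Delta>. card I = d} * card {I \<in> \<Delta>. card I = d + 2}
    \<le> (d + 1) * (card {I \<in> \<Delta>. card I = d + 1})\<^sup>2"
proof -
  \<comment> \<open>The inequality is available only for s > 0, where \<open>pt s\<close> is
    positive; continuity in s carries it to 0.\<close>
  have lim: "((\<lambda>s. indpoly s d \<Delta>) \<longlongrightarrow> indpoly 0 d \<Delta>) (at_right 0)" for d
    unfolding indpoly_def weight_def
    by (intro tendsto_intros) (auto intro!: tendsto_eq_intros)
  have "real (d + 2) * indpoly 0 d \<Delta> * indpoly 0 (d + 2) \<Delta> \<le> real (d + 1) * (indpoly 0 (d + 1) \<Delta>)\<^sup>2"
  proof (rule tendsto_le)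
    show "((\<lambda>s. real (d + 1) * (indpoly s (d + 1) \<Delta>)\<^sup>2) \<longlongrightarrow> real (d + 1) * (indpoly 0 (d + 1) \<Delta>)\<^sup>2) (at_right 0)"
      by (intro tendsto_intros lim)
    show "((\<lambda>s. real (d + 2) * indpoly s d \<Delta> * indpoly s (d + 2) \<Delta>)
        \<longlongrightarrow> real (d + 2) * indpoly 0 d \<Delta> * indpoly 0 (d + 2) \<Delta>) (at_right 0)"
      by (intro tendsto_intros lim)
    show "\<forall>\<^sub>F s in at_right 0. real (d + 2) * indpoly s d \<Delta> * indpoly s (d + 2) \<Delta> \<le> real (d + 1) * (indpoly s (d + 1) \<Delta>)\<^sup>2"
      using eventually_at_right_less by (rule eventually_mono) (rule indpoly_log_concave[OF assms])
  qed simp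
  then have "real ((d + 2) * card {I \<in> \<Delta>. card I = d} * card {I \<in> \<Delta>. card I = d + 2})
      \<le> real ((d + 1) * (card {I \<in> \<Delta>. card I = d + 1})\<^sup>2)"
    by (simp only: of_nat_mult of_nat_power indpoly_at_0[OF augmentingD(3)[OF assms]])
  then show ?thesis unfolding of_nat_le_iff .
qed

section \<open>The $h$-vector of a thickening\<close>

lemma matroid_augmenting: "matroid E \<Delta> \<Longrightarrow> augmenting E \<Delta>"
  unfolding matroid_def augmenting_def by blast

text \<open>Mason's factor (d+1)/(d+2) is below 1, hence strictness when the middle term is
  nonzero.\<close>

lemma fnum_log_concave_strict:
  assumes "matroid E \<Delta>" "fnum \<Delta> (Suc d) > 0"
  shows "fnum \<Delta> d * fnum \<Delta> (Suc (Suc d)) < (fnum \<Delta> (Suc d))\<^sup>2"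
proof (rule ccontr)
  let ?b = "(fnum \<Delta> (Suc d))\<^sup>2" and ?ac = "fnum \<Delta> d * fnum \<Delta> (Suc (Suc d))"
  assume "\<not> ?ac < ?b"
  then have "(d + 2) * ?b \<le> (d + 2) * ?ac" by (intro mult_le_mono2) simp
  also have "\<dots> \<le> (d + 1) * ?b"
    using mason_inequality[OF matroid_augmenting[OF assms(1)], of d] by (simp add: fnum_def mult.assoc del: mult_Suc)
  finally show False using assms(2) by simp
qed

lemma fnum_le_nonloops_power:
  assumes "matroid E \<Delta>"
  shows "fnum \<Delta> i \<le> nonloops E \<Delta> ^ i"
proof -
  note A = augmentingD[OF matroid_augmenting[OF assms]]
  let ?N = "{e \<in> E. {e} \<in> \<Delta>}"
  have fin: "finite ?N" using A(1) by simp
  have "{I \<in> \<Delta>. card I = i} \<subseteq> {I. I \<subseteq> ?N \<and> card I = i}"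
    using A(2) A(5) by fastforce
  then have "fnum \<Delta> i \<le> card {I. I \<subseteq> ?N \<and> card I = i}"
    unfolding fnum_def by (rule card_mono[rotated]) (use fin in simp)
  also have "\<dots> = nonloops E \<Delta> choose i"
    unfolding nonloops_def by (rule n_subsets[OF fin])
  also have "\<dots> \<le> nonloops E \<Delta> ^ i"
    by (cases "i \<le> nonloops E \<Delta>") (auto intro: binomial_le_pow simp: binomial_eq_0)
  finally show ?thesis .
qed

lemma basis_exists:
  assumes "matroid E \<Delta>"
  obtains B where "B \<in> \<Delta>" "card B = mrank \<Delta>"
proof -
  have "finite \<Delta>" "\<Delta> \<noteq> {}"
    using augmentingD(3)[OF matroid_augmenting[OF assms]] assms by (auto simp: matroid_def)
  then have "mrank \<Delta> \<in> card ` \<Delta>" unfolding mrank_def by (intro Max_in) auto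
  then show thesis using that by auto
qed

lemma mrank_le_nonloops:
  assumes "matroid E \<Delta>"
  shows "mrank \<Delta> \<le> nonloops E \<Delta>"
proof -
  note A = augmentingD[OF matroid_augmenting[OF assms]]
  obtain B where B: "B \<in> \<Delta>" "card B = mrank \<Delta>" using basis_exists[OF assms] .
  have "B \<subseteq> {e \<in> E. {e} \<in> \<Delta>}" using B(1) A(2) A(5)[OF B(1)] by auto
  then have "card B \<le> nonloops E \<Delta>"
    unfolding nonloops_def by (rule card_mono[rotated]) (use A(1) in simp)
  then show ?thesis using B by simp
qed

lemma fnum_pos:
  assumes "matroid E \<Delta>" "i \<le> mrank \<Delta>"
  shows "fnum \<Delta> i > 0"
proof -
  note A = augmentingD[OF matroid_augmenting[OF assms(1)]]
  obtain B where B: "B \<in> \<Delta>" "card B = mrank \<Delta>" using basis_exists[OF assms(1)] .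
  obtain I where "I \<subseteq> B" "card I = i"
    using obtain_subset_with_card_n[of i B] B assms(2) by metis
  then have "I \<in> {I \<in> \<Delta>. card I = i}" using A(5)[OF B(1)] by simp
  then show ?thesis unfolding fnum_def using A(3) by (subst card_gt_0_iff) auto
qed

lemma mrank_thick:
  assumes "matroid E \<Delta>" "k \<ge> 1"
  shows "mrank (thick_indep E \<Delta> k) = mrank \<Delta>"
proof -
  have "card ` thick_indep E \<Delta> k = card ` \<Delta>"
  proof
    show "card ` thick_indep E \<Delta> k \<subseteq> card ` \<Delta>"
      by (force simp: thick_indep_def)
    show "card ` \<Delta> \<subseteq> card ` thick_indep E \<Delta> k"
    proof
      fix c assume "c \<in> card ` \<Delta>"
      then obtain J where J: "J \<in> \<Delta>" "c = card J" by auto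
      have "J \<subseteq> E" using J(1) assms(1) by (auto simp: matroid_def)
      then have "J \<times> {1} \<in> thick_indep E \<Delta> k"
        using J assms(2) by (auto simp: thick_indep_def card_cartesian_product)
      moreover have "card (J \<times> {1::nat}) = c" using J by (simp add: card_cartesian_product)
      ultimately show "c \<in> card ` thick_indep E \<Delta> k" by (metis imageI)
    qed
  qed
  then show ?thesis by (simp add: mrank_def)
qed

text \<open>An independent set of the thickening is the graph of a function assigning to each
  element of some independent \<open>J\<close> one of its \<open>k\<close> copies.\<close>

lemma fnum_thick:
  assumes "matroid E \<Delta>"
  shows "fnum (thick_indep E \<Delta> k) i = k ^ i * fnum \<Delta> i"
proof -
  note A = augmentingD[OF matroid_augmenting[OF assms]]
  define X where "X = (SIGMA J:{J \<in> \<Delta>. card J = i}. PiE J (\<lambda>_. {1..k}))"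
  define \<phi> where "\<phi> = (\<lambda>(J, g). (\<lambda>e::'a. (e, g e :: nat)) ` J)"
  have card_graph: "card ((\<lambda>e. (e, g e)) ` J) = card J" for g :: "'a \<Rightarrow> nat" and J
    by (rule card_image) (auto simp: inj_on_def)
  have fst_graph: "fst ` (\<lambda>e. (e, g e)) ` J = J" for g :: "'a \<Rightarrow> nat" and J
    by force
  have "inj_on \<phi> X"
  proof (rule inj_onI)
    fix p q assume p: "p \<in> X" and q: "q \<in> X" and eq: "\<phi> p = \<phi> q"
    obtain J g J' g' where pq: "p = (J, g)" "q = (J', g')" by (metis surj_pair)
    have J: "J = J'" using arg_cong[OF eq, of "(`) fst"] by (simp add: pq \<phi>_def fst_graph)
    have "g e = g' e" if "e \<in> J" for e using eq that by (auto simp: pq \<phi>_def)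
    then have "g = g'" using p q J by (intro PiE_ext[of g J _ g']) (auto simp: pq X_def)
    with J pq show "p = q" by simp
  qed
  moreover have "\<phi> ` X = {I \<in> thick_indep E \<Delta> k. card I = i}"
  proof (intro equalityI subsetI)
    fix I assume "I \<in> \<phi> ` X"
    then obtain J g where Jg: "J \<in> \<Delta>" "card J = i" "g \<in> PiE J (\<lambda>_. {1..k})"
      and I: "I = (\<lambda>e. (e, g e)) ` J"
      by (auto simp: X_def \<phi>_def)
    have "I \<subseteq> E \<times> {1..k}" using Jg A(2) by (auto simp: I PiE_iff)
    then show "I \<in> {I \<in> thick_indep E \<Delta> k. card I = i}"
      using Jg by (simp add: thick_indep_def I fst_graph card_graph)
  next
    fix I assume "I \<in> {I \<in> thick_indep E \<Delta> k. card I = i}"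
    then have I: "I \<subseteq> E \<times> {1..k}" "fst ` I \<in> \<Delta>" "card (fst ` I) = card I" "card I = i"
      by (auto simp: thick_indep_def)
    have "finite I" by (rule finite_subset[OF I(1)]) (use A(1) in simp)
    then have inj: "inj_on fst I" using I(3) by (rule eq_card_imp_inj_on)
    \<comment> \<open>Equal cardinalities make \<open>fst\<close> injective on \<open>I\<close>, so
      \<open>I\<close> is a graph and \<open>g\<close> reads off the copy.\<close>
    define g where "g = restrict (\<lambda>e. snd (inv_into I fst e)) (fst ` I)"
    have g: "(fst x, g (fst x)) = x" if "x \<in> I" for x
      using that inj by (simp add: g_def)
    have "(\<lambda>e. (e, g e)) ` fst ` I = (\<lambda>x. x) ` I"
      unfolding image_image by (rule image_cong[OF refl]) (rule g)
    then have "\<phi> (fst ` I, g) = I" by (simp add: \<phi>_def)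
    moreover have "g e \<in> {1..k}" if "e \<in> fst ` I" for e
      using that I(1) g by (metis (no_types, lifting) imageE mem_Sigma_iff subsetD)
    then have "(fst ` I, g) \<in> X" using I by (auto simp: X_def g_def)
    ultimately show "I \<in> \<phi> ` X" by (metis imageI)
  qed
  ultimately have "fnum (thick_indep E \<Delta> k) i = card X"
    unfolding fnum_def by (metis card_image)
  also have "card X = (\<Sum>J\<in>{J \<in> \<Delta>. card J = i}. card (PiE J (\<lambda>_. {1..k})))"
    unfolding X_def by (rule card_SigmaI) (use A(3,4) in \<open>auto intro: finite_PiE\<close>)
  also have "\<dots> = (\<Sum>J\<in>{J \<in> \<Delta>. card J = i}. k ^ i)"
    by (rule sum.cong) (use A(4) in \<open>auto simp: card_PiE\<close>)
  finally show ?thesis by (simp add: fnum_def)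
qed

section \<open>Error estimates and the explicit threshold\<close>

lemma sum_powers_bound:
  fixes K :: real
  assumes "K \<ge> 2"
  shows "(\<Sum>i<j. K ^ i) \<le> 2 * K ^ j / K"
proof -
  have "K * (\<Sum>i<j. K ^ i) \<le> 2 * K ^ j"
  proof (induction j)
    case (Suc j)
    have "2 * K ^ j \<le> K * K ^ j"
      using assms by (intro mult_right_mono) auto
    then have "K * (2 * K ^ j) \<le> K * (K * K ^ j)"
      using assms by (intro mult_left_mono) auto
    then show ?case using Suc \<open>2 * K ^ j \<le> K * K ^ j\<close> by (simp add: algebra_simps)
  qed simp
  then show ?thesis using assms by (simp add: field_simps)
qed

text \<open>The summand i = j is the main term. In the others the binomial is at most r^r and f_i at
  most n^r, leaving \<open>N ^ mrank \<Delta>\<close> times a geometric sum.\<close>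

lemma hvec_thick_estimate:
  assumes M: "matroid E \<Delta>" and k: "k \<ge> 2" and j: "j \<le> mrank \<Delta>"
    and r: "mrank \<Delta> \<ge> 1"
  defines "N \<equiv> nonloops E \<Delta> * mrank \<Delta>"
  shows "\<bar>hvec (thick_indep E \<Delta> k) j - real k ^ j * fnum \<Delta> j\<bar> \<le> real k ^ j * (2 * N ^ mrank \<Delta> / k)"
proof -
  let ?r = "mrank \<Delta>" and ?n = "nonloops E \<Delta>"
  have n: "?n \<ge> 1" using mrank_le_nonloops[OF M] r by simp
  define t where "t i = (- 1) ^ (j - i) * real ((?r - i) choose (j - i)) * (real k ^ i * fnum \<Delta> i)" for i
  have "real_of_int (hvec (thick_indep E \<Delta> k) j) = (\<Sum>i\<le>j. t i)"
    using k by (simp add: hvec_def mrank_thick[OF M] fnum_thick[OF M] t_def atLeast0AtMost)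
  also have "\<dots> = (\<Sum>i<j. t i) + real k ^ j * fnum \<Delta> j"
    by (simp add: lessThan_Suc_atMost[symmetric] t_def)
  finally have "\<bar>hvec (thick_indep E \<Delta> k) j - real k ^ j * fnum \<Delta> j\<bar> = \<bar>\<Sum>i<j. t i\<bar>" by simp
  also have "\<dots> \<le> (\<Sum>i<j. \<bar>t i\<bar>)" by (rule sum_abs)
  also have "\<dots> \<le> (\<Sum>i<j. N ^ ?r * real k ^ i)"
  proof (rule sum_mono)
    fix i assume "i \<in> {..<j}"
    then have i: "i < j" by simp
    have "(?r - i) choose (j - i) \<le> (?r - i) ^ (j - i)"
      using i j by (intro binomial_le_pow) auto
    also have "\<dots> \<le> ?r ^ (j - i)" by (rule power_mono) auto
    also have "\<dots> \<le> ?r ^ ?r" using r j by (intro power_increasing) auto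
    finally have c: "(?r - i) choose (j - i) \<le> ?r ^ ?r" .
    have "fnum \<Delta> i \<le> ?n ^ i" by (rule fnum_le_nonloops_power[OF M])
    also have "\<dots> \<le> ?n ^ ?r" using n i j by (intro power_increasing) auto
    finally have "((?r - i) choose (j - i)) * fnum \<Delta> i \<le> ?r ^ ?r * ?n ^ ?r"
      using c by (intro mult_mono) auto
    also have "\<dots> = N ^ ?r" by (simp add: N_def power_mult_distrib)
    finally have "real (((?r - i) choose (j - i)) * fnum \<Delta> i) \<le> real (N ^ ?r)"
      by (simp only: of_nat_le_iff)
    then have "real ((?r - i) choose (j - i)) * fnum \<Delta> i * real k ^ i \<le> N ^ ?r * real k ^ i"
      by (intro mult_right_mono) auto
    then show "\<bar>t i\<bar> \<le> N ^ ?r * real k ^ i" by (simp add: t_def abs_mult mult_ac)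
  qed
  also have "\<dots> \<le> N ^ ?r * (2 * real k ^ j / k)"
    unfolding sum_distrib_left[symmetric] using k by (intro mult_left_mono sum_powers_bound) auto
  finally show ?thesis by (simp add: mult_ac)
qed

text \<open>Up to powers of \<open>K\<close> the claim is (a + e)(c + e) <= (b - e)^2 with e =
  \<open>\<epsilon>\<close>; e^2 cancels, and \<open>small\<close> keeps the linear terms within the
  gap 1.\<close>

lemma perturbed_log_concave:
  fixes a b c K \<epsilon> :: real
  assumes gap: "a * c + 1 \<le> b\<^sup>2" and small: "\<epsilon> * (2 * b + a + c) \<le> 1"
    and nonneg: "a \<ge> 0" "b \<ge> 1" "c \<ge> 0" "\<epsilon> \<ge> 0" "K \<ge> 0"
    and x: "\<bar>x - K ^ j * a\<bar> \<le> K ^ j * \<epsilon>"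
    and y: "\<bar>y - K ^ Suc j * b\<bar> \<le> K ^ Suc j * \<epsilon>"
    and z: "\<bar>z - K ^ Suc (Suc j) * c\<bar> \<le> K ^ Suc (Suc j) * \<epsilon>"
  shows "x * z \<le> y\<^sup>2"
proof -
  \<comment> \<open>This gives \<open>\<epsilon>\<close> <= 1/2, so the lower bound on
    \<open>y\<close> is nonnegative and can be squared.\<close>
  have "\<epsilon> * 2 \<le> \<epsilon> * (2 * b + a + c)" using nonneg by (intro mult_left_mono) auto
  then have "\<epsilon> \<le> b" using small nonneg by linarith
  have pw: "K ^ m \<ge> 0" for m using nonneg by simp
  have "\<bar>x\<bar> \<le> K ^ j * (a + \<epsilon>)" "\<bar>z\<bar> \<le> K ^ Suc (Suc j) * (c + \<epsilon>)"
    using x z mult_nonneg_nonneg[OF pw nonneg(1)] mult_nonneg_nonneg[OF pw nonneg(3)]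
    unfolding distrib_left by (smt (verit))+
  then have "\<bar>x\<bar> * \<bar>z\<bar> \<le> (K ^ j * (a + \<epsilon>)) * (K ^ Suc (Suc j) * (c + \<epsilon>))"
    by (intro mult_mono) (use nonneg in auto)
  then have "x * z \<le> (K ^ Suc j)\<^sup>2 * ((a + \<epsilon>) * (c + \<epsilon>))"
    using abs_ge_self[of "x * z"] by (simp add: abs_mult power2_eq_square mult_ac)
  also have "\<dots> \<le> (K ^ Suc j)\<^sup>2 * (b - \<epsilon>)\<^sup>2"
  proof (rule mult_left_mono)
    show "(a + \<epsilon>) * (c + \<epsilon>) \<le> (b - \<epsilon>)\<^sup>2"
      using gap small by (simp add: power2_eq_square algebra_simps)
  qed simp
  also have "\<dots> = (K ^ Suc j * (b - \<epsilon>))\<^sup>2" by (simp add: power_mult_distrib)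
  also have "\<dots> \<le> y\<^sup>2"
  proof (rule power_mono)
    show "K ^ Suc j * (b - \<epsilon>) \<le> y" using y unfolding right_diff_distrib by linarith
    show "0 \<le> K ^ Suc j * (b - \<epsilon>)" using nonneg \<open>\<epsilon> \<le> b\<close> by simp
  qed
  finally show ?thesis .
qed

theorem mainTheorem4:
  fixes E :: "'e set" and \<Delta> :: "'e set set"
  assumes "matroid E \<Delta>"
    and "realizable_over TYPE('a::field) E \<Delta>"
  shows "\<exists>k0::nat. k0 \<le> (nonloops E \<Delta> * mrank \<Delta>) ^ (3 * mrank \<Delta>) \<and>
           (\<forall>k::nat. k \<ge> 1 \<and> k \<ge> k0 \<longrightarrow>
              (\<forall>j. 1 \<le> j \<and> j + 1 \<le> mrank \<Delta> \<longrightarrow>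
                 (hvec (thick_indep E \<Delta> k) j)^2 \<ge>
                   hvec (thick_indep E \<Delta> k) (j - 1) * hvec (thick_indep E \<Delta> k) (j + 1)))"
proof -
  let ?r = "mrank \<Delta>" and ?n = "nonloops E \<Delta>"
  let ?N = "?n * ?r"
  \<comment> \<open>The witness \<open>k0\<close> is the bound itself.\<close>
  have "hvec (thick_indep E \<Delta> k) (j - 1) * hvec (thick_indep E \<Delta> k) (j + 1) \<le> (hvec (thick_indep E \<Delta> k) j)\<^sup>2"
    if k: "k \<ge> ?N ^ (3 * ?r)" and j: "1 \<le> j" "j + 1 \<le> ?r" for k j
  proof -
    obtain i where i: "j = Suc i" using j by (cases j) auto
    \<comment> \<open>An admissible \<open>j\<close> forces rank at least 2; smaller ranks are
      vacuous.\<close>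
    have r: "?r \<ge> 2" using j by simp
    have n: "?n \<ge> 2" using mrank_le_nonloops[OF assms(1)] r by linarith
    have "8 \<le> (4::nat) ^ 2" by simp
    also have "\<dots> \<le> 4 ^ ?r" by (rule power_increasing[OF r]) simp
    also have "\<dots> \<le> ?N ^ ?r" using mult_le_mono[OF n r] by (intro power_mono) auto
    finally have N8: "8 \<le> ?N ^ ?r" .
    have "?n ^ ?r \<le> ?N ^ ?r" using r by (intro power_mono) auto
    \<comment> \<open>The 8 is 2 from \<open>\<epsilon>\<close> times 4 from the bound on 2b + a +
      c. One factor N^r absorbs the 8 and another absorbs n^r, whence the exponent 3r.\<close>
    then have "8 * (?n ^ ?r * ?N ^ ?r) \<le> ?N ^ ?r * (?N ^ ?r * ?N ^ ?r)"
      using N8 by (intro mult_le_mono) auto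
    also have "\<dots> = ?N ^ (3 * ?r)"
      by (simp only: power_add[symmetric]) (simp only: mult_Suc numeral_3_eq_3 mult_0 add_0_right)
    finally have big: "8 * (?n ^ ?r * ?N ^ ?r) \<le> k" using k by linarith
    have "1 \<le> ?n ^ ?r" using n by simp
    then have "8 * (1 * 1) \<le> 8 * (?n ^ ?r * ?N ^ ?r)" using N8 by (intro mult_le_mono) auto
    then have k2: "k \<ge> 2" using big by linarith
    define \<epsilon> where "\<epsilon> = 2 * real (?N ^ ?r) / real k"
    have f: "fnum \<Delta> m \<le> ?n ^ ?r" if "m \<le> ?r" for m
      using fnum_le_nonloops_power[OF assms(1), of m] power_increasing[OF that, of ?n] n by linarith
    have est: "\<bar>real_of_int (hvec (thick_indep E \<Delta> k) m) - real k ^ m * real (fnum \<Delta> m)\<bar> \<le> real k ^ m * \<epsilon>"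
      if "m \<le> ?r" for m
      using hvec_thick_estimate[OF assms(1) k2 that] r by (simp add: \<epsilon>_def)
    have b: "fnum \<Delta> (Suc i) > 0" using fnum_pos[OF assms(1)] i j by simp
    have "real_of_int (hvec (thick_indep E \<Delta> k) i) * real_of_int (hvec (thick_indep E \<Delta> k) (Suc (Suc i)))
      \<le> (real_of_int (hvec (thick_indep E \<Delta> k) (Suc i)))\<^sup>2"
    proof (rule perturbed_log_concave[where K = "real k" and j = i])
      have "fnum \<Delta> i * fnum \<Delta> (Suc (Suc i)) + 1 \<le> (fnum \<Delta> (Suc i))\<^sup>2"
        using fnum_log_concave_strict[OF assms(1) b] by simp
      then have "real (fnum \<Delta> i * fnum \<Delta> (Suc (Suc i)) + 1) \<le> real ((fnum \<Delta> (Suc i))\<^sup>2)"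
        by (simp only: of_nat_le_iff)
      then show "real (fnum \<Delta> i) * real (fnum \<Delta> (Suc (Suc i))) + 1 \<le> (real (fnum \<Delta> (Suc i)))\<^sup>2"
        by simp
      have "2 * fnum \<Delta> (Suc i) + fnum \<Delta> i + fnum \<Delta> (Suc (Suc i)) \<le> 4 * ?n ^ ?r"
        using f[of i] f[of "Suc i"] f[of "Suc (Suc i)"] i j by simp
      then have "2 * ?N ^ ?r * (2 * fnum \<Delta> (Suc i) + fnum \<Delta> i + fnum \<Delta> (Suc (Suc i)))
          \<le> 2 * ?N ^ ?r * (4 * ?n ^ ?r)" by (rule mult_le_mono2)
      also have "\<dots> \<le> k" using big by (simp add: mult_ac)
      finally have "real (2 * ?N ^ ?r * (2 * fnum \<Delta> (Suc i) + fnum \<Delta> i + fnum \<Delta> (Suc (Suc i)))) \<le> real k"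
        by (simp only: of_nat_le_iff)
      then show "\<epsilon> * (2 * real (fnum \<Delta> (Suc i)) + real (fnum \<Delta> i) + real (fnum \<Delta> (Suc (Suc i)))) \<le> 1"
        using k2 by (simp add: \<epsilon>_def field_simps)
      show "\<epsilon> \<ge> 0" by (simp add: \<epsilon>_def)
    qed (use b est[of i] est[of "Suc i"] est[of "Suc (Suc i)"] i j in \<open>simp_all del: power_Suc\<close>)
    then have "real_of_int (hvec (thick_indep E \<Delta> k) i * hvec (thick_indep E \<Delta> k) (Suc (Suc i)))
      \<le> real_of_int ((hvec (thick_indep E \<Delta> k) (Suc i))\<^sup>2)" by simp
    then show ?thesis unfolding of_int_le_iff by (simp add: i)
  qed
  then show ?thesis by blast
qed

end
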